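(* Let $r\ge1$ and let $F(x,y) = \sum_{j=0}^{r} f_{j}(x) y^{j} \in \mathbb Z[x,y]$, where the only common divisors of $f_{0}(x), \ldots, f_{r}(x)$ in $\mathbb Z[x]$ are $\pm1$, $f_{0}(0) \ne 0$, and $f_{r}(x) \ne 0$. Suppose that for every non-negative integer $t$ and every positive integer $\ell$, each of the polynomials \[ f_{0}(x) + f_{1}(x) x^{t} y^{\ell} + \cdots + f_{r-1}(x) x^{(r-1)t} y^{(r-1)\ell} + f_{r}(x) x^{rt} y^{r \ell} \] and \[ f_{0}(x) x^{rt} + f_{1}(x) x^{(r-1)t} y^{\ell} + \cdots + f_{r-1}(x) x^{t} y^{(r-1)\ell} + f_{r}(x) y^{r \ell} \] is a power of $x$ (possibly $x^{0}$) times an irreducible polynomial in $\mathbb Z[x,y]$. Then for every sufficiently large positive integer $n$ (i.e. for all $n\ge N$ with $N$ depending only on $f_0,\dots,f_r$), the non-reciprocal part of $F(x,x^{n})$ is not reducible, i.e. it is either $1$ or irreducible.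
   Context: For nonzero $f(x)\in\mathbb Q[x]$, its reciprocal is $\tilde f(x)=x^{\deg f}f(1/x)$, and $f$ is reciprocal if $f=\pm\tilde f$. The non-reciprocal part of a nonzero $f(x)\in\mathbb Z[x]$ is $f(x)$ with every irreducible reciprocal factor in $\mathbb Z[x]$ having positive leading coefficient removed, to the full multiplicity with which it divides $f$, so only irreducible non-reciprocal factors remain.
   Formalization: The conclusion is that the non-reciprocal part is 1, -1 or irreducible (i.e. not reducible): -1 must be allowed, since the sign of F(x,x^n) is kept, e.g. f_0=-(x+3), f_1=-(3x+1) gives -1 for all large n. *)

theory Defs
  imports "HOL-Computational_Algebra.Computational_Algebra"
begin

text \<open>
  For nonzero \<open>f\<close>, the library's \<^const>\<open>reflect_poly\<close> \<open>f\<close> (the coefficient list reversed) is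
  \<open>x ^ degree f * f (1 / x)\<close>.
\<close>

definition reciprocal :: "'a::comm_ring_1 poly \<Rightarrow> bool" where
  "reciprocal f \<longleftrightarrow> f = reflect_poly f \<or> f = - reflect_poly f"

text \<open>
  Irreducibility is meant in the ring of integer polynomials, so the rational primes, as constant
  polynomials, are among the irreducible reciprocal factors, while the variable \<open>x\<close> is not. The sign
  of \<open>f\<close> stays in the non-reciprocal part.
\<close>

definition reciprocal_factors :: "int poly \<Rightarrow> int poly set" where
  "reciprocal_factors f =
     {p. irreducible p \<and> reciprocal p \<and> lead_coeff p > 0 \<and> p dvd f}"

definition nonreciprocal_part :: "int poly \<Rightarrow> int poly" where
  "nonreciprocal_part f = f div (\<Prod>p\<in>reciprocal_factors f. p ^ multiplicity p f)"

text \<open>For nonzero \<open>f\<close> the product is finite and the division is exact.\<close>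

lemma reciprocal_factors_subset:
  assumes "f \<noteq> 0"
  shows "reciprocal_factors f \<subseteq> prime_factors f"
proof
  fix p assume p: "p \<in> reciprocal_factors f"
  then have "prime_elem p"
    by (auto simp: reciprocal_factors_def prime_elem_iff_irreducible)
  moreover have "normalize p = p"
    using p by (simp add: reciprocal_factors_def normalize_poly_eq_map_poly map_poly_idI)
  ultimately show "p \<in> prime_factors f"
    using p assms by (auto simp: prime_factors_dvd prime_def reciprocal_factors_def)
qed

lemma finite_reciprocal_factors: "f \<noteq> 0 \<Longrightarrow> finite (reciprocal_factors f)"
  by (rule finite_subset[OF reciprocal_factors_subset]) auto

lemma nonreciprocal_part_mult:
  assumes "f \<noteq> 0"
  shows "nonreciprocal_part f * (\<Prod>p\<in>reciprocal_factors f. p ^ multiplicity p f) = f"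
proof -
  have "(\<Prod>p\<in>reciprocal_factors f. p ^ multiplicity p f)
          dvd (\<Prod>p\<in>prime_factors f. p ^ multiplicity p f)"
    by (rule prod_dvd_prod_subset) (use reciprocal_factors_subset[OF assms] in auto)
  also have "\<dots> = prod_mset (prime_factorization f)"
    by (simp add: prod_mset_multiplicity count_prime_factorization_prime in_prime_factors_imp_prime)
  also have "\<dots> dvd f"
    using prod_mset_prime_factorization_weak[OF assms] by (metis associated_iff_dvd)
  finally show ?thesis
    by (simp add: nonreciprocal_part_def)
qed

text \<open>
  Polynomials in \<open>x\<close> and \<open>y\<close> over the integers are represented as polynomials in \<open>y\<close> whose coefficients
  are polynomials in \<open>x\<close>.
\<close>

abbreviation var_x :: "int poly poly" where
  "var_x \<equiv> [:[:0, 1:]:]"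

abbreviation var_y :: "int poly poly" where
  "var_y \<equiv> [:0, 1:]"

end

theory Submission
  imports Defs "HOL-Analysis.Kronecker_Approximation_Theorem"
begin

text \<open>
  If the non-reciprocal part of \<open>G(x) = F(x, x^n)\<close> were reducible, then \<open>G = u w\<close> with both factors
  non-reciprocal. Write \<open>P~\<close> for the reciprocal of \<open>P\<close> and put \<open>W = u w~\<close>, so that \<open>W W~ = G G~\<close>. Comparing
  the middle coefficients, \<open>W\<close> and \<open>G\<close> have the same Euclidean norm, so the number of terms of \<open>W\<close> is
  bounded independently of \<open>n\<close>. By simultaneous Diophantine approximation some \<open>k = n div q\<close> with \<open>q\<close>
  bounded has the property that all exponents of \<open>W\<close> and \<open>G\<close> are within \<open>k / 8\<close> of multiples of \<open>k\<close>.
  Hence, up to powers of \<open>x\<close>, the identity \<open>W W~ = G G~\<close> is the specialisation at \<open>y = x^k\<close> of an identity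
  of polynomials in \<open>x\<close> and \<open>y\<close> whose degree in \<open>x\<close> is less than \<open>k\<close>, where \<open>G\<close> lifts to
  \<open>\<Sum> f\<^sub>j x^(jt) y^(jq)\<close> with \<open>t = n mod q\<close>. This lift is a power of \<open>x\<close> times a prime element, which
  divides the lift of \<open>W\<close> or that of \<open>W~\<close>; specialising again, \<open>G\<close> divides \<open>W\<close> or \<open>W~\<close>. So \<open>W\<close> is
  \<open>G\<close> or \<open>G~\<close> up to sign, which makes \<open>w\<close> or \<open>u\<close> reciprocal.
\<close>

section \<open>Factors of reciprocal products, and splitting off two non-reciprocal factors\<close>

lemma reciprocal_mult:
  fixes p q :: "'a::idom poly"
  assumes "reciprocal p" "reciprocal q"
  shows "reciprocal (p * q)"
proof -
  have "(p = reflect_poly p \<or> p = - reflect_poly p) \<and> (q = reflect_poly q \<or> q = - reflect_poly q)"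
    using assms by (simp add: reciprocal_def)
  then have "p * q = reflect_poly p * reflect_poly q \<or> p * q = - (reflect_poly p * reflect_poly q)"
    by (metis minus_mult_left minus_mult_minus minus_mult_right)
  then show ?thesis
    by (simp add: reciprocal_def reflect_poly_mult)
qed

lemma reciprocal_mult_cancel:
  fixes p q :: "'a::idom poly"
  assumes "reciprocal (p * q)" "reciprocal q" "q \<noteq> 0"
  shows "reciprocal p"
proof -
  have q: "reflect_poly q = q \<or> reflect_poly q = - q"
    using assms(2) unfolding reciprocal_def by (metis minus_minus)
  have "p * q = reflect_poly p * reflect_poly q \<or> p * q = - (reflect_poly p * reflect_poly q)"
    using assms(1) by (simp add: reciprocal_def reflect_poly_mult)
  with q have "p * q = reflect_poly p * q \<or> p * q = (- reflect_poly p) * q"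
    by auto
  with \<open>q \<noteq> 0\<close> show ?thesis
    unfolding reciprocal_def by (metis mult_cancel_right)
qed

text \<open>With the plus sign, p = p~ or p = -p~. With the minus sign, p^2 + p~^2 = 0 at every
  integer, which forces p = 0.\<close>

lemma reciprocal_square_cancel:
  fixes p :: "int poly"
  assumes "reciprocal (p * p)"
  shows "reciprocal p"
proof -
  let ?q = "reflect_poly p"
  consider "p * p = ?q * ?q" | "p * p = - (?q * ?q)"
    using assms by (auto simp: reciprocal_def reflect_poly_mult)
  then show ?thesis
  proof cases
    case 1
    then show ?thesis by (simp add: reciprocal_def square_eq_iff)
  next
    case 2
    have "poly p x = 0" for x
    proof -
      have "poly p x * poly p x + poly ?q x * poly ?q x = 0"
        using arg_cong[OF 2, of "\<lambda>u. poly u x"] by simp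
      then show ?thesis by (simp add: sum_squares_eq_zero_iff)
    qed
    then have "p = 0" using poly_all_0_iff_0 by blast
    then show ?thesis by (simp add: reciprocal_def)
  qed
qed

text \<open>The cofactor \<open>v\<close> is attached to \<open>q\<close> or to \<open>p\<close> if
  that product stays non-reciprocal. If both products become reciprocal, the split is
  \<open>p * q\<close> times \<open>v\<close>: a reciprocal \<open>v\<close> would make
  \<open>q\<close> reciprocal, and a reciprocal \<open>p * q\<close> would make \<open>p * p\<close>
  reciprocal.\<close>

lemma nonreciprocal_split:
  fixes p q v :: "int poly"
  assumes "\<not> reciprocal p" "\<not> reciprocal q" "v \<noteq> 0"
  obtains u w where "p * q * v = u * w" "\<not> reciprocal u" "\<not> reciprocal w"
proof -
  have nz: "p \<noteq> 0" "q \<noteq> 0"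
    using assms by (auto simp: reciprocal_def)
  consider "\<not> reciprocal (q * v)" | "\<not> reciprocal (p * v)"
    | "reciprocal (q * v)" "reciprocal (p * v)" by blast
  then show ?thesis
  proof cases
    case 1
    then show ?thesis using that[of p "q * v"] assms(1) by (simp add: mult_ac)
  next
    case 2
    then show ?thesis using that[of q "p * v"] assms(2) by (simp add: mult_ac)
  next
    case 3
    have "\<not> reciprocal v"
      using reciprocal_mult_cancel[of q v] 3 assms by blast
    moreover have "\<not> reciprocal (p * q)"
    proof
      assume "reciprocal (p * q)"
      with 3(2) have "reciprocal ((p * v) * (p * q))" by (rule reciprocal_mult)
      also have "(p * v) * (p * q) = (p * p) * (q * v)" by (simp add: mult_ac)
      finally have "reciprocal ((p * p) * (q * v))" .
      then have "reciprocal (p * p)"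
        by (rule reciprocal_mult_cancel) (use 3 nz assms(3) in auto)
      with assms(1) reciprocal_square_cancel show False by blast
    qed
    ultimately show ?thesis using that[of "p * q" v] by (simp add: mult_ac)
  qed
qed

text \<open>Otherwise \<open>p\<close> or \<open>- p\<close> is a removed factor. Since it was
  removed to full multiplicity, one more copy of it would divide \<open>G\<close> to too high a
  power.\<close>

lemma irreducible_dvd_nonreciprocal_part:
  assumes "G \<noteq> 0" "irreducible p" "p dvd nonreciprocal_part G"
  shows "\<not> reciprocal p"
proof
  assume p: "reciprocal p"
  \<comment> \<open>Only factors with positive leading coefficient are removed, hence the change of
    sign.\<close>
  obtain s :: "int poly" where s: "s = p \<or> s = - p" "lead_coeff s > 0"
  proof (cases "lead_coeff p > 0")
    case False
    have "p \<noteq> 0" using assms(2) by auto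
    then have "lead_coeff p \<noteq> 0" by simp
    with False have "lead_coeff (- p) > 0" by (simp add: not_less order.not_eq_order_implies_strict)
    then show ?thesis using that by blast
  qed (use that in blast)
  let ?\<Pi> = "\<Prod>p\<in>reciprocal_factors G. p ^ multiplicity p G"
  have fact: "nonreciprocal_part G * ?\<Pi> = G"
    by (rule nonreciprocal_part_mult[OF assms(1)])
  have sdvd: "s dvd nonreciprocal_part G" using s(1) assms(3) by auto
  have irr: "irreducible s"
    using s(1) assms(2) irreducible_mult_unit_left[of "-1" p] by auto
  have "reflect_poly (- p) = - reflect_poly p"
    using reflect_poly_smult[of "-1" p] by simp
  then have "reciprocal s" using s(1) p by (auto simp: reciprocal_def)
  moreover have "s dvd G" using sdvd fact by (metis dvd_mult2)
  ultimately have "s \<in> reciprocal_factors G"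
    using irr s(2) by (simp add: reciprocal_factors_def)
  then have "s ^ multiplicity s G dvd ?\<Pi>"
    using dvd_prodI[OF finite_reciprocal_factors[OF assms(1)], of s "\<lambda>p. p ^ multiplicity p G"]
    by simp
  with sdvd have "s ^ Suc (multiplicity s G) dvd nonreciprocal_part G * ?\<Pi>"
    by (simp add: mult_dvd_mono)
  then have "s ^ Suc (multiplicity s G) dvd G" by (simp add: fact)
  moreover have "\<not> is_unit s" using irr by (simp add: irreducible_def)
  ultimately show False
    using power_dvd_iff_le_multiplicity[of G s "Suc (multiplicity s G)"] assms(1)
    by (metis Suc_n_not_le_n)
qed

text \<open>Each of the two nonunit factors of the non-reciprocal part contains a prime, necessarily
  non-reciprocal. Everything else, including the removed reciprocal factors, is the cofactor
  distributed by \<open>nonreciprocal_split\<close>.\<close>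

lemma reducible_nonreciprocal_part_split:
  fixes G :: "int poly"
  assumes "G \<noteq> 0" "\<not> is_unit (nonreciprocal_part G)" "\<not> irreducible (nonreciprocal_part G)"
  obtains u w where "G = u * w" "\<not> reciprocal u" "\<not> reciprocal w"
proof -
  let ?h = "nonreciprocal_part G"
  obtain c where c: "G = ?h * c"
    using nonreciprocal_part_mult[OF assms(1)] by metis
  with assms(1) have nz: "?h \<noteq> 0" "c \<noteq> 0" by auto
  with assms(2,3) obtain a b where ab: "?h = a * b" "\<not> is_unit a" "\<not> is_unit b"
    by (auto simp: irreducible_def)
  with nz have "a \<noteq> 0" "b \<noteq> 0" by auto
  then obtain p q where pq: "prime p" "p dvd a" "prime q" "q dvd b"
    using ab prime_divisor_exists by metis
  then obtain a' b' where a'b': "a = p * a'" "b = q * b'" by (auto elim!: dvdE)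
  have "\<not> reciprocal p"
    using irreducible_dvd_nonreciprocal_part[OF assms(1)] pq ab(1)
    by (metis dvd_mult2 prime_elem_imp_irreducible prime_imp_prime_elem)
  moreover have "\<not> reciprocal q"
    using irreducible_dvd_nonreciprocal_part[OF assms(1)] pq ab(1)
    by (metis dvd_mult prime_elem_imp_irreducible prime_imp_prime_elem)
  moreover have "a' * b' * c \<noteq> 0" using a'b' \<open>a \<noteq> 0\<close> \<open>b \<noteq> 0\<close> nz by simp
  ultimately obtain u w where "p * q * (a' * b' * c) = u * w" "\<not> reciprocal u" "\<not> reciprocal w"
    by (rule nonreciprocal_split)
  moreover have "G = p * q * (a' * b' * c)" using c ab(1) a'b' by (simp add: mult_ac)
  ultimately show ?thesis using that by metis
qed

section \<open>Substituting x^k for y, and lifting back to two variables\<close>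

text \<open>The blocks belonging to different powers of y do not overlap: the lowest coefficient
  would be a multiple of x^k of degree below k, so it vanishes, and induction handles the
  rest.\<close>

lemma kronecker_substitution_eq_0:
  fixes P :: "'a::idom poly poly"
  assumes "\<And>i. degree (coeff P i) < k" "poly P (monom 1 k) = 0"
  shows "P = 0"
  using assms
proof (induction P)
  case (pCons a P)
  have a: "degree a < k" using pCons.prems(1)[of 0] by simp
  have P: "degree (coeff P i) < k" for i using pCons.prems(1)[of "Suc i"] by simp
  have eq: "a = - (monom 1 k * poly P (monom 1 k))"
    using pCons.prems(2) by (simp add: eq_neg_iff_add_eq_0)
  have "poly P (monom 1 k) = 0"
  proof (rule ccontr)
    assume "poly P (monom 1 k) \<noteq> 0"
    then have "degree (monom 1 k * poly P (monom 1 k)) = k + degree (poly P (monom 1 k))"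
      by (simp add: degree_mult_eq degree_monom_eq)
    with eq a show False by simp
  qed
  with eq P pCons.IH show ?case by simp
qed simp

lemma degree_coeff_mult_le:
  fixes P Q :: "'a::comm_semiring_0 poly poly"
  assumes "\<And>i. degree (coeff P i) \<le> a" "\<And>i. degree (coeff Q i) \<le> b"
  shows "degree (coeff (P * Q) i) \<le> a + b"
  unfolding coeff_mult
  by (rule degree_sum_le) (use assms in \<open>auto intro: order_trans[OF degree_mult_le] add_mono\<close>)

text \<open>The centre \<open>p\<close> is an integer so that centres can be subtracted, as
  reflection requires.\<close>

definition near_multiples :: "nat \<Rightarrow> nat \<Rightarrow> 'a::zero poly \<Rightarrow> bool" where
  "near_multiples k B P \<longleftrightarrow> (\<forall>i. coeff P i \<noteq> 0 \<longrightarrow> (\<exists>p::int. \<bar>int i - int k * p\<bar> \<le> int B))"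

lemma near_multiples_mono:
  "near_multiples k B P \<Longrightarrow> B \<le> C \<Longrightarrow> near_multiples k C P"
  unfolding near_multiples_def by (meson of_nat_mono order_trans)

text \<open>An exponent of P~ is the degree minus an exponent of P. Both lie within \<open>B\<close>
  of multiples of \<open>k\<close>, and the errors add.\<close>

lemma near_multiples_reflect:
  assumes "near_multiples k B P"
  shows "near_multiples k (2 * B) (reflect_poly P)"
  unfolding near_multiples_def
proof (intro allI impI)
  fix i assume i: "coeff (reflect_poly P) i \<noteq> 0"
  then have "i \<le> degree P" "coeff P (degree P - i) \<noteq> 0" "lead_coeff P \<noteq> 0"
    by (auto simp: coeff_reflect_poly split: if_splits)
  then obtain p s :: int where "\<bar>int (degree P - i) - int k * p\<bar> \<le> int B"
    "\<bar>int (degree P) - int k * s\<bar> \<le> int B"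
    using assms by (metis near_multiples_def)
  with \<open>i \<le> degree P\<close> have "\<bar>int i - int k * (s - p)\<bar> \<le> int (2 * B)"
    by (simp add: right_diff_distrib of_nat_diff)
  then show "\<exists>p. \<bar>int i - int k * p\<bar> \<le> int (2 * B)" by blast
qed

text \<open>
  The factor \<open>x^C\<close> makes all residues of the exponents modulo \<open>k\<close> lie in \<open>{0..2 * C}\<close>.
\<close>

lemma near_multiples_lift:
  fixes P :: "'a::comm_ring_1 poly"
  assumes "near_multiples k C P" "2 * C < k"
  obtains A :: "'a poly poly"
    where "\<And>i. degree (coeff A i) \<le> 2 * C" "poly A (monom 1 k) = monom 1 C * P"
proof -
  \<comment> \<open>Division of \<open>i + C\<close> by \<open>k\<close> gives the exponent of y as
    quotient and that of x as remainder.\<close>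
  define A where "A = (\<Sum>i\<le>degree P. monom (monom (coeff P i) ((i + C) mod k)) ((i + C) div k))"
  have "degree (coeff A j) \<le> 2 * C" for j
    unfolding A_def coeff_sum
  proof (rule degree_sum_le)
    fix i assume "i \<in> {..degree P}"
    show "degree (coeff (monom (monom (coeff P i) ((i + C) mod k)) ((i + C) div k)) j) \<le> 2 * C"
    proof (cases "coeff P i = 0")
      case False
      with assms(1) obtain p :: int where p: "\<bar>int i - int k * p\<bar> \<le> int C"
        unfolding near_multiples_def by blast
      have "int ((i + C) mod k) = (int k * p + (int i - int k * p + int C)) mod int k"
        by (simp add: zmod_int)
      also have "\<dots> = (int i - int k * p + int C) mod int k"
        by (rule mod_mult_self4)
      also have "\<dots> = int i - int k * p + int C"
        using p assms(2) by (intro mod_pos_pos_trivial) auto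
      finally have "(i + C) mod k \<le> 2 * C" using p by linarith
      then show ?thesis
        using degree_monom_le[of "coeff P i" "(i + C) mod k"] by auto
    qed simp
  qed simp
  moreover have "poly A (monom 1 k) = (\<Sum>i\<le>degree P. monom 1 C * monom (coeff P i) i)"
    unfolding A_def poly_sum
  proof (rule sum.cong)
    fix i
    have "(i + C) mod k + k * ((i + C) div k) = C + i" using mod_mult_div_eq[of "i + C" k] by simp
    then show "poly (monom (monom (coeff P i) ((i + C) mod k)) ((i + C) div k)) (monom 1 k)
        = monom 1 C * monom (coeff P i) i"
      by (simp add: poly_monom monom_power mult_monom add.commute)
  qed simp
  then have "poly A (monom 1 k) = monom 1 C * P"
    by (simp add: sum_distrib_left[symmetric] poly_as_sum_of_monoms)
  ultimately show ?thesis using that by blast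
qed

section \<open>From divisibility to equality up to sign and reflection\<close>

lemma dvd_x_power_mult_imp_dvd:
  fixes G W :: "int poly"
  assumes "coeff G 0 \<noteq> 0" "G dvd [:0, 1:] ^ m * W"
  shows "G dvd W"
proof -
  have "prime_elem [:0, 1::int:]" by (rule prime_elem_linear_poly) auto
  moreover have "\<not> [:0, 1:] dvd G"
    using assms(1) by (simp add: dvd_iff_poly_eq_0[of 0, simplified] poly_0_coeff_0)
  ultimately have "coprime [:0, 1:] G" by (rule prime_elem_imp_coprime)
  then have "coprime G ([:0, 1:] ^ m)" by (simp add: coprime_commute)
  with assms(2) show ?thesis by (simp add: coprime_dvd_mult_right_iff)
qed

text \<open>Equal degrees make the quotient a constant c, and comparing the two products gives c^2 =
  1.\<close>

lemma eq_or_uminus_of_dvd: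
  fixes G W :: "int poly"
  assumes "G dvd W" "degree W = degree G" "W * reflect_poly W = G * reflect_poly G" "G \<noteq> 0"
  shows "W = G \<or> W = - G"
proof -
  obtain s where s: "W = G * s" using assms(1) by blast
  have "W \<noteq> 0" using assms(3,4) by auto
  with s have "degree W = degree G + degree s" by (auto simp: degree_mult_eq)
  with assms(2) obtain c where c: "s = [:c:]" by (auto elim: degree_eq_zeroE)
  have "(G * reflect_poly G) * [:c * c:] = G * reflect_poly G"
    using assms(3) unfolding s c reflect_poly_mult by (simp add: mult_ac)
  moreover have "G * reflect_poly G \<noteq> 0" using assms(4) by simp
  ultimately have "[:c * c:] = 1" by (metis mult_cancel_left mult.right_neutral)
  then have "c * c = 1" by (simp add: one_pCons)
  then have "c = 1 \<or> c = -1" by (simp add: square_eq_1_iff)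
  then show ?thesis by (auto simp: s c)
qed

text \<open>The irreducible \<open>g\<close> is prime in Z[x, y] and divides the product of the
  lifts \<open>A\<close> of W and \<open>A'\<close> of W~. The case \<open>g dvd A\<close> gives W =
  G or W = -G, the other case the same for W~.\<close>

lemma eq_up_to_reflection:
  fixes G W :: "int poly" and Fh g :: "int poly poly"
  assumes Fh: "Fh = var_x ^ \<kappa> * g" and g: "irreducible g"
    and G: "poly Fh (monom 1 k) = G" and G0: "coeff G 0 \<noteq> 0" and W0: "coeff W 0 \<noteq> 0"
    and deg: "degree W = degree G" and WG: "W * reflect_poly W = G * reflect_poly G"
    and nW: "near_multiples k B W" and nG: "near_multiples k B G" and k: "8 * B < k"
    and dF: "\<And>i. degree (coeff Fh i) \<le> 2 * B"
  shows "W = G \<or> W = - G \<or> W = reflect_poly G \<or> W = - reflect_poly G"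
proof -
  \<comment> \<open>Reflection doubles the distance to multiples of \<open>k\<close>, so this
    \<open>C\<close> serves W, G and their reflections. Products of two lifts then have degree at
    most \<open>4 * C\<close> in x, which is below \<open>k\<close>.\<close>
  define C where "C = 2 * B"
  have C: "4 * C < k" using k by (simp add: C_def)
  obtain A where A: "\<And>i. degree (coeff A i) \<le> 2 * C" "poly A (monom 1 k) = monom 1 C * W"
    using near_multiples_lift[of k C W] near_multiples_mono[OF nW, of C] C by (auto simp: C_def)
  obtain A' where A': "\<And>i. degree (coeff A' i) \<le> 2 * C"
      "poly A' (monom 1 k) = monom 1 C * reflect_poly W"
    using near_multiples_lift[of k C "reflect_poly W"] near_multiples_reflect[OF nW] C
    by (auto simp: C_def)
  obtain G' where G': "\<And>i. degree (coeff G' i) \<le> 2 * C"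
      "poly G' (monom 1 k) = monom 1 C * reflect_poly G"
    using near_multiples_lift[of k C "reflect_poly G"] near_multiples_reflect[OF nG] C
    by (auto simp: C_def)
  \<comment> \<open>The other three lifts carry a factor x^C; giving one to \<open>Fh\<close> makes
    x^(2C) appear on both sides after substitution.\<close>
  define Gh where "Gh = [:monom 1 C:] * Fh"
  have Gh: "degree (coeff Gh i) \<le> 2 * C" for i
  proof -
    have "degree (coeff Gh i) \<le> degree (monom (1::int) C) + degree (coeff Fh i)"
      unfolding Gh_def by (simp add: degree_mult_le)
    also have "\<dots> \<le> C + C" using dF[of i] by (intro add_mono) (auto simp: degree_monom_le C_def)
    finally show ?thesis by simp
  qed
  have "A * A' - Gh * G' = 0"
  proof (rule kronecker_substitution_eq_0)
    fix i
    have "degree (coeff (A * A') i) \<le> 2 * C + 2 * C" "degree (coeff (Gh * G') i) \<le> 2 * C + 2 * C"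
      by (rule degree_coeff_mult_le; fact)+
    then have "degree (coeff (A * A' - Gh * G') i) \<le> 2 * C + 2 * C"
      by (simp add: degree_diff_le)
    also have "\<dots> < k" using C by simp
    finally show "degree (coeff (A * A' - Gh * G') i) < k" .
  next
    have "poly (A * A' - Gh * G') (monom 1 k) =
        monom 1 C * monom 1 C * (W * reflect_poly W - G * reflect_poly G)"
      by (simp add: A A' G' Gh_def G algebra_simps)
    then show "poly (A * A' - Gh * G') (monom 1 k) = 0" by (simp add: WG)
  qed
  then have "A * A' = g * ([:monom 1 C:] * var_x ^ \<kappa> * G')"
    by (simp only: right_minus_eq Gh_def Fh mult_ac)
  then have "g dvd A * A'" by (rule dvdI)
  moreover have "prime_elem g" using g by (rule irreducible_imp_prime_elem)
  ultimately have "g dvd A \<or> g dvd A'" using prime_elem_dvd_multD by blast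
  \<comment> \<open>Specialising at y = x^k turns divisibility by \<open>g\<close> into divisibility
    by G up to a power of x, which is harmless because G(0) is nonzero.\<close>
  have *: "G dvd V" if "g dvd R" "poly R (monom 1 k) = monom 1 C * V" for R V
  proof -
    obtain s where s: "R = g * s" using \<open>g dvd R\<close> by blast
    have "G * poly s (monom 1 k) = [:0, 1:] ^ \<kappa> * (monom 1 C * V)"
      unfolding that(2)[symmetric] G[symmetric] Fh s by (simp add: mult_ac)
    also have "\<dots> = [:0, 1:] ^ (\<kappa> + C) * V"
      by (simp add: monom_altdef power_add mult_ac)
    finally have "G dvd [:0, 1:] ^ (\<kappa> + C) * V" by (metis dvd_triv_left)
    with G0 show ?thesis by (rule dvd_x_power_mult_imp_dvd)
  qed
  have nz: "G \<noteq> 0" using G0 by auto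
  have "W = G \<or> W = - G" if "g dvd A"
    using eq_or_uminus_of_dvd[OF *[OF that A(2)] deg WG nz] .
  moreover have "reflect_poly W = G \<or> reflect_poly W = - G" if "g dvd A'"
    by (rule eq_or_uminus_of_dvd[OF *[OF that A'(2)] _ _ nz]) (use W0 deg WG in \<open>simp_all add: mult.commute\<close>)
  then have "W = reflect_poly G \<or> W = - reflect_poly G" if "g dvd A'"
    using that reflect_poly_reflect_poly[OF W0] reflect_poly_smult[of "-1" G]
    by (metis smult_1_left smult_minus_left)
  ultimately show ?thesis using \<open>g dvd A \<or> g dvd A'\<close> by blast
qed

section \<open>Bounding the number of terms by the Euclidean norm\<close>

lemma coeff_mult_reflect_self:
  fixes W :: "'a::comm_ring_1 poly"
  shows "coeff (W * reflect_poly W) (degree W) = (\<Sum>i\<le>degree W. (coeff W i)\<^sup>2)"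
  unfolding coeff_mult
  by (rule sum.cong) (auto simp: coeff_reflect_poly power2_eq_square)

text \<open>A nonzero integer has square at least 1.\<close>

lemma card_support_le_sum_squares:
  fixes W :: "int poly"
  shows "int (card {i. coeff W i \<noteq> 0}) \<le> (\<Sum>i\<le>degree W. (coeff W i)\<^sup>2)"
proof -
  have sub: "{i. coeff W i \<noteq> 0} \<subseteq> {..degree W}" by (auto intro: le_degree)
  have "int (card {i. coeff W i \<noteq> 0}) = (\<Sum>i | coeff W i \<noteq> 0. 1)" by simp
  also have "\<dots> \<le> (\<Sum>i | coeff W i \<noteq> 0. (coeff W i)\<^sup>2)"
  proof (rule sum_mono)
    fix i assume "i \<in> {i. coeff W i \<noteq> 0}"
    then have "(coeff W i)\<^sup>2 > 0" by simp
    then show "1 \<le> (coeff W i)\<^sup>2" by linarith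
  qed
  also have "\<dots> \<le> (\<Sum>i\<le>degree W. (coeff W i)\<^sup>2)"
    by (rule sum_mono2) (use sub in auto)
  finally show ?thesis .
qed

lemma sum_squares_le_square_sum_abs:
  fixes a :: "'b \<Rightarrow> 'a::linordered_idom"
  assumes "finite I"
  shows "(\<Sum>i\<in>I. (a i)\<^sup>2) \<le> (\<Sum>i\<in>I. \<bar>a i\<bar>)\<^sup>2"
proof -
  have "(\<Sum>i\<in>I. (a i)\<^sup>2) \<le> (\<Sum>i\<in>I. \<bar>a i\<bar> * (\<Sum>j\<in>I. \<bar>a j\<bar>))"
  proof (rule sum_mono)
    fix i assume "i \<in> I"
    then have "\<bar>a i\<bar> \<le> (\<Sum>j\<in>I. \<bar>a j\<bar>)" by (intro member_le_sum) (auto simp: assms)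
    then have "\<bar>a i\<bar> * \<bar>a i\<bar> \<le> \<bar>a i\<bar> * (\<Sum>j\<in>I. \<bar>a j\<bar>)" by (rule mult_left_mono) simp
    then show "(a i)\<^sup>2 \<le> \<bar>a i\<bar> * (\<Sum>j\<in>I. \<bar>a j\<bar>)" by (simp add: power2_eq_square)
  qed
  then show ?thesis by (simp add: sum_distrib_right power2_eq_square)
qed

lemma sum_abs_coeff_shift_le:
  fixes f :: "int poly"
  shows "(\<Sum>i\<le>D. \<bar>coeff (monom 1 m * f) i\<bar>) \<le> (\<Sum>i\<le>degree f. \<bar>coeff f i\<bar>)"
proof -
  let ?S = "{i. i \<le> D \<and> m \<le> i \<and> i - m \<le> degree f}"
  have "(\<Sum>i\<le>D. \<bar>coeff (monom 1 m * f) i\<bar>) = (\<Sum>i\<in>?S. \<bar>coeff f (i - m)\<bar>)"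
    by (rule sum.mono_neutral_cong_right) (auto simp: coeff_monom_mult intro: le_degree)
  also have "\<dots> = (\<Sum>i\<in>(\<lambda>i. i - m) ` ?S. \<bar>coeff f i\<bar>)"
    by (subst sum.reindex) (auto simp: inj_on_def)
  also have "\<dots> \<le> (\<Sum>i\<le>degree f. \<bar>coeff f i\<bar>)"
    by (rule sum_mono2) auto
  finally show ?thesis .
qed

text \<open>The bound does not involve the shifts \<open>m j\<close>; this makes the number of terms
  of W bounded uniformly in n.\<close>

lemma sum_squares_sparse_le:
  fixes f :: "nat \<Rightarrow> int poly"
  assumes "G = (\<Sum>j\<le>r. monom 1 (m j) * f j)"
  shows "(\<Sum>i\<le>D. (coeff G i)\<^sup>2) \<le> (\<Sum>j\<le>r. \<Sum>i\<le>degree (f j). \<bar>coeff (f j) i\<bar>)\<^sup>2"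
proof -
  have "(\<Sum>i\<le>D. \<bar>coeff G i\<bar>) \<le> (\<Sum>i\<le>D. \<Sum>j\<le>r. \<bar>coeff (monom 1 (m j) * f j) i\<bar>)"
    unfolding assms coeff_sum by (intro sum_mono sum_abs)
  also have "\<dots> = (\<Sum>j\<le>r. \<Sum>i\<le>D. \<bar>coeff (monom 1 (m j) * f j) i\<bar>)"
    by (rule sum.swap)
  also have "\<dots> \<le> (\<Sum>j\<le>r. \<Sum>i\<le>degree (f j). \<bar>coeff (f j) i\<bar>)"
    by (intro sum_mono sum_abs_coeff_shift_le)
  finally have "(\<Sum>i\<le>D. \<bar>coeff G i\<bar>)\<^sup>2 \<le> (\<Sum>j\<le>r. \<Sum>i\<le>degree (f j). \<bar>coeff (f j) i\<bar>)\<^sup>2"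
    by (intro power_mono sum_nonneg) auto
  with sum_squares_le_square_sum_abs[of "{..D}" "coeff G"] show ?thesis by simp
qed

section \<open>Simultaneous approximation of the exponents\<close>

text \<open>
  If \<open>q * d / n\<close> is within \<open>1 / 16\<close> of an integer \<open>p\<close>, then \<open>d\<close> is within \<open>n / (16 * q)\<close> of \<open>p * (n / q)\<close>;
  rounding \<open>n / q\<close> down to an integer costs at most \<open>\<bar>p\<bar>\<close>, which is bounded.
\<close>

lemma common_approximate_divisor:
  fixes M c L :: nat
  obtains N where "\<And>n S. n \<ge> N \<Longrightarrow> finite S \<Longrightarrow> card S \<le> M \<Longrightarrow> S \<subseteq> {..c * n} \<Longrightarrow>
    \<exists>q>0. q \<le> 16 ^ M \<and> L \<le> n div q div 10 \<and>
      (\<forall>d\<in>S. \<exists>p::int. \<bar>int d - int (n div q) * p\<bar> \<le> int (n div q div 10))"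
proof -
  define Q :: nat where "Q = 16 ^ M"
  \<comment> \<open>A lower bound for \<open>k = n div q\<close>. The summand
    \<open>10 * (L + 1)\<close> ensures \<open>L \<le> k div 10\<close>; the other one makes the
    total error (Q c + 1) + (k + 1) / 16 at most k / 10 - 1, where the 1 pays for rounding k / 10
    down.\<close>
  define K where "K = 10 * (L + 1) + 40 * (Q * c + 3)"
  have "\<exists>q>0. q \<le> 16 ^ M \<and> L \<le> n div q div 10 \<and>
      (\<forall>d\<in>S. \<exists>p::int. \<bar>int d - int (n div q) * p\<bar> \<le> int (n div q div 10))"
    if n: "n \<ge> Q * K" and S: "finite S" "card S \<le> M" "S \<subseteq> {..c * n}" for n and S :: "nat set"
  proof -
    have Q: "Q > 0" by (simp add: Q_def)
    have "K > 0" by (simp add: K_def)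
    then have n0: "n > 0" using n Q by (metis mult_pos_pos order_less_le_trans)
    obtain e where e: "bij_betw e {..<card S} S"
      using ex_bij_betw_nat_finite[OF S(1)] by (auto simp: atLeast0LessThan)
    \<comment> \<open>Dividing by n puts the exponents into the fixed interval [0, c]. Parameter 16
      gives error 1 / 16 and a denominator bounded independently of n.\<close>
    obtain q p where qp: "0 < q" "q \<le> int (16 ^ card S)"
      "\<And>i. i < card S \<Longrightarrow> \<bar>of_int q * (real (e i) / real n) - of_int (p i)\<bar> < 1 / 16"
      using Dirichlet_approx_simult[of 16 "card S" "\<lambda>i. real (e i) / real n"] by auto
    define u where "u = nat q"
    have u: "u > 0" "of_int q = real u" using qp(1) by (auto simp: u_def)
    have "(16::nat) ^ card S \<le> Q" unfolding Q_def using S(2) by (intro power_increasing) auto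
    then have uQ: "u \<le> Q" using qp(2) unfolding u_def by linarith
    define k where "k = n div u"
    have "K \<le> n div Q" using n Q by (simp add: less_eq_div_iff_mult_less_eq mult.commute)
    also have "\<dots> \<le> k" unfolding k_def using u uQ by (intro div_le_mono2) auto
    finally have kK: "K \<le> k" .
    have k1: "real k \<le> real n / real u" "real n / real u < real k + 1"
    proof -
      have "k * u \<le> n" by (simp add: k_def)
      then have "real k * real u \<le> real n" by (metis of_nat_le_iff of_nat_mult)
      then show "real k \<le> real n / real u" using u by (simp add: field_simps)
      have "n < (k + 1) * u" unfolding k_def using dividend_less_div_times[OF u(1), of n] by simp
      then have "real n < (real k + 1) * real u" by (metis of_nat_less_iff of_nat_mult of_nat_add of_nat_1)
      then show "real n / real u < real k + 1" using u by (simp add: field_simps)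
    qed
    have "\<exists>p::int. \<bar>int d - int k * p\<bar> \<le> int (k div 10)" if d: "d \<in> S" for d
    proof -
      obtain i where i: "i < card S" "d = e i" using e d by (auto simp: bij_betw_def)
      define \<epsilon> where "\<epsilon> = real u * (real d / real n) - real_of_int (p i)"
      have eps: "\<bar>\<epsilon>\<bar> < 1 / 16" using qp(3)[OF i(1)] by (simp add: \<epsilon>_def i u)
      have d_eq: "real d = real n / real u * (real_of_int (p i) + \<epsilon>)"
        using n0 u by (simp add: \<epsilon>_def field_simps)
      have "d \<le> c * n" using S(3) d by auto
      then have "real d \<le> real c * real n" by (metis of_nat_le_iff of_nat_mult)
      then have "real d / real n \<le> real c" using n0 by (simp add: field_simps)
      then have "real u * (real d / real n) \<le> real Q * real c" using uQ by (intro mult_mono) auto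
      moreover have "real u * (real d / real n) \<ge> 0" by simp
      moreover have "\<bar>z\<bar> \<le> y + 1" if "x \<le> y" "x \<ge> 0" "\<bar>x - z\<bar> < 1 / 16" for x y z :: real
        using that by linarith
      ultimately have pb: "\<bar>real_of_int (p i)\<bar> \<le> real Q * real c + 1"
        using eps unfolding \<epsilon>_def by blast
      have "real d - real k * real_of_int (p i) =
          (real n / real u - real k) * real_of_int (p i) + real n / real u * \<epsilon>"
        unfolding d_eq by (simp add: algebra_simps add_divide_distrib)
      then have "\<bar>real d - real k * real_of_int (p i)\<bar> \<le>
          \<bar>(real n / real u - real k) * real_of_int (p i)\<bar> + \<bar>real n / real u * \<epsilon>\<bar>"
        by (simp only: abs_triangle_ineq)
      also have "\<dots> \<le> 1 * (real Q * real c + 1) + (real k + 1) * (1 / 16)"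
        unfolding abs_mult
        by (intro add_mono mult_mono) (use k1 pb eps in auto)
      also have "\<dots> \<le> real k / 10 - 1"
      proof -
        have bound: "1 * (x + 1) + (z + 1) * (1 / 16) \<le> z / 10 - 1"
          if "130 + 10 * y + 40 * x \<le> z" "x \<ge> 0" "y \<ge> 0" for x y z :: real
        proof -
          have "(z + 1) * (1 / 16) = z / 16 + 1 / 16" by (simp add: field_simps)
          moreover have "x + 1 + (z / 16 + 1 / 16) \<le> z / 10 - 1" using that by linarith
          ultimately show ?thesis by (simp only: mult_1)
        qed
        have "real K \<le> real k" using kK by simp
        then show ?thesis
          by (intro bound[of "real L"]) (simp_all add: K_def)
      qed
      also have "\<dots> \<le> real (k div 10)" by linarith
      finally have "real_of_int \<bar>int d - int k * p i\<bar> \<le> real_of_int (int (k div 10))" by simp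
      then show ?thesis by (metis of_int_le_iff)
    qed
    moreover have "L \<le> k div 10" using kK by (simp add: K_def)
    ultimately show ?thesis using u(1) uQ unfolding k_def Q_def by blast
  qed
  then show ?thesis using that by blast
qed

section \<open>Applying the dichotomy to a hypothetical factorisation\<close>

theorem theorem4:
  fixes r :: nat and f :: "nat \<Rightarrow> int poly" and F :: "int poly poly"
  assumes "r \<ge> 1"
    and "F = (\<Sum>j\<le>r. [:f j:] * var_y ^ j)"
    and "\<And>d :: int poly. (\<forall>j\<le>r. d dvd f j) \<Longrightarrow> d = 1 \<or> d = -1"
    and "poly (f 0) 0 \<noteq> 0"
    and "f r \<noteq> 0"
    and "\<And>t l :: nat. l > 0 \<Longrightarrow>
           \<exists>k g. irreducible g \<and>
             (\<Sum>j\<le>r. [:f j:] * var_x ^ (j * t) * var_y ^ (j * l)) = var_x ^ k * g"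
    and "\<And>t l :: nat. l > 0 \<Longrightarrow>
           \<exists>k g. irreducible g \<and>
             (\<Sum>j\<le>r. [:f j:] * var_x ^ ((r - j) * t) * var_y ^ (j * l)) = var_x ^ k * g"
  shows "\<exists>N. \<forall>n\<ge>N. n > 0 \<longrightarrow>
           (let h = nonreciprocal_part (poly F (monom 1 n))
            in h = 1 \<or> h = -1 \<or> irreducible h)"
proof -
  define E where "E = (\<Sum>j\<le>r. degree (f j))"
  have E: "degree (f j) \<le> E" if "j \<le> r" for j
    unfolding E_def using that by (intro member_le_sum) auto
  define M where "M = nat ((\<Sum>j\<le>r. \<Sum>i\<le>degree (f j). \<bar>coeff (f j) i\<bar>)\<^sup>2)"
  \<comment> \<open>The value of \<open>L\<close> is chosen because t = n mod q is less than q,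
    hence at most 16^M, so that E + r t will be at most \<open>B\<close>. The factor
    \<open>r + 1\<close> bounds deg G once n is at least \<open>E\<close>.\<close>
  obtain N where N: "\<And>n S. n \<ge> N \<Longrightarrow> finite S \<Longrightarrow> card S \<le> M \<Longrightarrow> S \<subseteq> {..(r + 1) * n} \<Longrightarrow>
    \<exists>q>0. q \<le> 16 ^ M \<and> E + r * 16 ^ M \<le> n div q div 10 \<and>
      (\<forall>d\<in>S. \<exists>p::int. \<bar>int d - int (n div q) * p\<bar> \<le> int (n div q div 10))"
    using common_approximate_divisor by blast
  have "h = 1 \<or> h = -1 \<or> irreducible h"
    if n: "n \<ge> N + E" "n > 0" and h: "h = nonreciprocal_part (poly F (monom 1 n))" for n h
  proof (rule ccontr)
    assume contra: "\<not> (h = 1 \<or> h = -1 \<or> irreducible h)"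
    define G where "G = poly F (monom 1 n)"
    have G: "G = (\<Sum>j\<le>r. monom 1 (j * n) * f j)"
      by (simp add: G_def assms(2) poly_sum monom_power mult_ac)
    have "coeff G 0 = (\<Sum>j\<le>r. if j = 0 then coeff (f 0) 0 else 0)"
      unfolding G coeff_sum by (rule sum.cong) (use n in \<open>auto simp: coeff_monom_mult\<close>)
    then have G0: "coeff G 0 \<noteq> 0" using assms(4) by (simp add: poly_0_coeff_0)
    then have Gnz: "G \<noteq> 0" by auto
    have supp_G: "\<exists>j\<le>r. \<exists>a\<le>E. i = a + j * n" if "coeff G i \<noteq> 0" for i
    proof -
      from that obtain j where j: "j \<le> r" "coeff (monom 1 (j * n) * f j) i \<noteq> 0"
        unfolding G coeff_sum by (metis (mono_tags, lifting) atMost_iff sum.neutral)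
      then have "j * n \<le> i" "coeff (f j) (i - j * n) \<noteq> 0"
        by (auto simp: coeff_monom_mult split: if_splits)
      then have "i - j * n \<le> E" using le_degree E[OF j(1)] order_trans by blast
      with j(1) \<open>j * n \<le> i\<close> show ?thesis
        by (intro exI[of _ j] exI[of _ "i - j * n"] conjI) auto
    qed
    have degG: "degree G \<le> (r + 1) * n"
    proof -
      have "coeff G (degree G) \<noteq> 0" using Gnz by simp
      then obtain j a where "j \<le> r" "a \<le> E" "degree G = a + j * n" using supp_G by blast
      moreover have "j * n \<le> r * n" using \<open>j \<le> r\<close> by simp
      moreover have "(r + 1) * n = r * n + n" by simp
      ultimately show ?thesis using n(1) by linarith
    qed
    have "\<not> is_unit (nonreciprocal_part G)"
    proof
      assume "is_unit (nonreciprocal_part G)"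
      then obtain c where "nonreciprocal_part G = [:c:]" "is_unit c"
        by (auto simp: is_unit_poly_iff)
      with contra show False
        by (auto simp: h G_def[symmetric] one_pCons abs_if split: if_splits)
    qed
    then obtain u w where uw: "G = u * w" "\<not> reciprocal u" "\<not> reciprocal w"
      using reducible_nonreciprocal_part_split[OF Gnz] contra by (auto simp: h G_def)
    have uw0: "coeff u 0 \<noteq> 0" "coeff w 0 \<noteq> 0"
      using G0 unfolding uw by (auto simp: coeff_mult)
    then have nz: "u \<noteq> 0" "w \<noteq> 0" by auto
    define W where "W = u * reflect_poly w"
    have rW: "reflect_poly W = reflect_poly u * w"
      using uw0 by (simp add: W_def reflect_poly_mult)
    have W0: "coeff W 0 \<noteq> 0" using uw0 nz by (simp add: W_def coeff_mult)
    have deg: "degree W = degree G"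
      unfolding W_def uw using uw0 nz by (subst degree_mult_eq) (auto simp: degree_mult_eq)
    have WG: "W * reflect_poly W = G * reflect_poly G"
      unfolding rW unfolding W_def uw reflect_poly_mult by (simp add: mult_ac)
    let ?S = "{i. coeff W i \<noteq> 0}"
    have "int (card ?S) \<le> (\<Sum>i\<le>degree G. (coeff G i)\<^sup>2)"
      using card_support_le_sum_squares[of W] coeff_mult_reflect_self[of W]
        coeff_mult_reflect_self[of G] WG deg by simp
    also have "\<dots> \<le> (\<Sum>j\<le>r. \<Sum>i\<le>degree (f j). \<bar>coeff (f j) i\<bar>)\<^sup>2"
      by (rule sum_squares_sparse_le[OF G])
    finally have "card ?S \<le> M" unfolding M_def by linarith
    moreover have S: "?S \<subseteq> {..degree W}" by (auto intro: le_degree)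
    ultimately obtain q where q: "q > 0" "q \<le> 16 ^ M" "E + r * 16 ^ M \<le> n div q div 10"
      "\<And>d. d \<in> ?S \<Longrightarrow> \<exists>p::int. \<bar>int d - int (n div q) * p\<bar> \<le> int (n div q div 10)"
      using N[of n ?S] n finite_subset[OF S] degG deg by fastforce
    define k where "k = n div q"
    define t where "t = n mod q"
    define B where "B = k div 10"
    have nkq: "n = k * q + t" by (simp add: k_def t_def)
    have "t \<le> 16 ^ M" unfolding t_def using q(1,2) by (meson mod_less_divisor less_imp_le order_trans)
    then have "r * t \<le> r * 16 ^ M" by simp
    then have EB: "E + r * t \<le> B" using q(3) unfolding B_def k_def by linarith
    \<comment> \<open>Since j n = k (j q) + j t, the power x^(j n) is x^(j t) y^(j q) at y = x^k.
      This is the first family of the hypotheses with l = q.\<close>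
    define Fh where "Fh = (\<Sum>j\<le>r. [:f j:] * var_x ^ (j * t) * var_y ^ (j * q))"
    obtain \<kappa> g where g: "irreducible g" "Fh = var_x ^ \<kappa> * g"
      using assms(6)[OF q(1), of t] unfolding Fh_def by blast
    have Fh: "Fh = (\<Sum>j\<le>r. monom (f j * monom 1 (j * t)) (j * q))"
      unfolding Fh_def
    proof (rule sum.cong)
      fix j
      have "var_x ^ (j * t) = [:monom 1 (j * t):]"
        by (induction "j * t" rule: nat_induct) (simp_all add: poly_const_pow monom_altdef)
      then show "[:f j:] * var_x ^ (j * t) * var_y ^ (j * q) = monom (f j * monom 1 (j * t)) (j * q)"
        by (simp add: monom_altdef[of _ "j * q"] mult.commute)
    qed simp
    have FhG: "poly Fh (monom 1 k) = G"
      unfolding Fh G poly_sum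
      by (rule sum.cong) (simp_all add: poly_monom monom_power mult_monom nkq algebra_simps)
    have dF: "degree (coeff Fh i) \<le> 2 * B" for i
      unfolding Fh coeff_sum
    proof (rule degree_sum_le)
      fix j assume "j \<in> {..r}"
      then have "degree (f j) + j * t \<le> E + r * t" using E by (intro add_mono) auto
      moreover have "degree (f j * monom 1 (j * t)) \<le> degree (f j) + j * t"
        by (rule order_trans[OF degree_mult_le]) (simp add: degree_monom_eq)
      ultimately have "degree (f j * monom 1 (j * t)) \<le> 2 * B" using EB by linarith
      then show "degree (coeff (monom (f j * monom 1 (j * t)) (j * q)) i) \<le> 2 * B" by simp
    qed simp
    have nG: "near_multiples k B G"
      unfolding near_multiples_def
    proof (intro allI impI)
      fix i assume "coeff G i \<noteq> 0"
      then obtain j a where ja: "j \<le> r" "a \<le> E" "i = a + j * n" using supp_G by blast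
      have "int i - int k * int (j * q) = int (a + j * t)"
        unfolding ja(3) by (simp add: nkq algebra_simps)
      moreover have "a + j * t \<le> E + r * t" using ja by (intro add_mono mult_right_mono) auto
      ultimately have "\<bar>int i - int k * int (j * q)\<bar> \<le> int B" using EB by linarith
      then show "\<exists>p. \<bar>int i - int k * p\<bar> \<le> int B" by blast
    qed
    have nW: "near_multiples k B W"
      using q(4) by (auto simp: near_multiples_def k_def B_def)
    \<comment> \<open>From 10 B \<le> k the strict bound 8 B < k follows only for positive
      \<open>B\<close>; here r \<ge> 1 provides it.\<close>
    have "E + r * 16 ^ M > 0" using assms(1) by simp
    then have "B > 0" using q(3) unfolding B_def k_def by linarith
    then have "8 * B < k" unfolding B_def by linarith
    then have "W = G \<or> W = - G \<or> W = reflect_poly G \<or> W = - reflect_poly G"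
      using eq_up_to_reflection[OF g(2,1) FhG G0 W0 deg WG nW nG _ dF] by blast
    \<comment> \<open>Cancelling \<open>u\<close> in the first two cases and
      \<open>reflect_poly w\<close> in the last two makes \<open>w\<close> or \<open>u\<close>
      reciprocal.\<close>
    then consider "u * reflect_poly w = u * w" | "u * reflect_poly w = u * (- w)"
      | "u * reflect_poly w = reflect_poly u * reflect_poly w"
      | "u * reflect_poly w = (- reflect_poly u) * reflect_poly w"
      unfolding W_def uw reflect_poly_mult by auto
    then have "reciprocal w \<or> reciprocal u"
      unfolding reciprocal_def using nz
      by cases (metis mult_cancel_left mult_cancel_right reflect_poly_eq_0_iff minus_minus)+
    with uw show False by blast
  qed
  then show ?thesis unfolding Let_def by blast
qed

end
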